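(* Let $G$ be a finite group. If $|G|\ge 16$ and $G$ has a subgroup of index $2$, then $G$ has non $\mathcal{P}$-interval metrics, i.e. there is an invariant metric on $G$ which is not $\mathcal{P}$-interval. In particular, any abelian group of even order $2n$ with $n\ge 8$ has non $\mathcal{P}$-interval metrics.
   Context: All metrics on groups are integral (integer valued) and right translation invariant: $d(gh,g'h)=d(g,g')$ for all $g,g',h\in G$. The weight of $d$ is $w(x)=d(x,e)$, $e$ the identity of $G$. The partition induced by $d$, denoted $P(G,d)$, is the set of classes of the equivalence relation $g\sim h\Leftrightarrow w(g)=w(h)$. An interval metric is such a metric $d$ with finitely many weights and without gaps: if $P(G,d)$ has $m$ parts different from $\{e\}$, then the set of values of $w$ is exactly $\{0,1,\ldots,m\}$. A metric $d$ on $G$ is $\mathcal{P}$-interval if there is an interval metric $d'$ on $G$ with $P(G,d)=P(G,d')$. *)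

theory Defs
  imports "HOL-Analysis.Abstract_Metric_Spaces" "HOL-Algebra.Coset"
begin

text \<open>Following \<open>Metric_space\<close>, metrics are real-valued and total on the type; integrality and
  invariance are required on the carrier only. Symmetry and nonnegativity off the carrier, which
  \<open>Metric_space\<close> also demands, are no restriction: nothing below depends on values there.\<close>

definition invariant_metric :: "('a, 'b) monoid_scheme \<Rightarrow> ('a \<Rightarrow> 'a \<Rightarrow> real) \<Rightarrow> bool" where
  "invariant_metric G d \<longleftrightarrow>
     Metric_space (carrier G) d \<and>
     (\<forall>x\<in>carrier G. \<forall>y\<in>carrier G. d x y \<in> \<int>) \<and>
     (\<forall>g\<in>carrier G. \<forall>g'\<in>carrier G. \<forall>h\<in>carrier G.
        d (g \<otimes>\<^bsub>G\<^esub> h) (g' \<otimes>\<^bsub>G\<^esub> h) = d g g')"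

definition weight :: "('a, 'b) monoid_scheme \<Rightarrow> ('a \<Rightarrow> 'a \<Rightarrow> real) \<Rightarrow> 'a \<Rightarrow> real" where
  "weight G d x = d x \<one>\<^bsub>G\<^esub>"

definition metric_partition ::
    "('a, 'b) monoid_scheme \<Rightarrow> ('a \<Rightarrow> 'a \<Rightarrow> real) \<Rightarrow> 'a set set" where
  "metric_partition G d =
     carrier G // {(g, h). g \<in> carrier G \<and> h \<in> carrier G \<and> weight G d g = weight G d h}"

text \<open>Finiteness of the set of weights is stated explicitly because \<^const>\<open>card\<close> of an infinite
  set is \<open>0\<close>.\<close>

definition interval_metric :: "('a, 'b) monoid_scheme \<Rightarrow> ('a \<Rightarrow> 'a \<Rightarrow> real) \<Rightarrow> bool" where
  "interval_metric G d \<longleftrightarrow>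
     invariant_metric G d \<and>
     finite (weight G d ` carrier G) \<and>
     weight G d ` carrier G = real ` {0..card (metric_partition G d - {{\<one>\<^bsub>G\<^esub>}})}"

definition P_interval :: "('a, 'b) monoid_scheme \<Rightarrow> ('a \<Rightarrow> 'a \<Rightarrow> real) \<Rightarrow> bool" where
  "P_interval G d \<longleftrightarrow>
     invariant_metric G d \<and>
     (\<exists>d'. interval_metric G d' \<and> metric_partition G d' = metric_partition G d)"

end

theory Submission
  imports Defs "HOL-Algebra.Sylow"
begin

text \<open>Let \<open>H\<close> have index \<open>2\<close>. Split \<open>G - H\<close>, which has at least \<open>8\<close> elements, into three
  inverse-closed sets \<open>A\<^sub>1, A\<^sub>2, A\<^sub>3\<close> with at least two elements each, and put \<open>B = H - {e}\<close>. The
  partition into \<open>{e}, B, A\<^sub>1, A\<^sub>2, A\<^sub>3\<close> comes from a metric with nonzero weights in \<open>{4..8}\<close>.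
  An interval metric would give \<open>B, A\<^sub>1, A\<^sub>2, A\<^sub>3\<close> the weights \<open>1, 2, 3, 4\<close> in some order, say
  \<open>b\<close> and \<open>a\<^sub>i\<close>. As the quotient of two distinct elements of \<open>G - H\<close> lies in \<open>B\<close>, we have
  \<open>a\<^sub>i \<le> a\<^sub>j + b\<close> and \<open>b \<le> 2 a\<^sub>i\<close>. If \<open>b = 1\<close>, the weights \<open>2\<close> and \<open>4\<close> of two \<open>A\<^sub>i\<close> are too far
  apart; otherwise some \<open>a\<^sub>i = 1\<close>, hence \<open>b = 2\<close> and all \<open>a\<^sub>j \<le> 3\<close>.

  An abelian group of even order has an involution, so squaring is not surjective; a maximal
  proper subgroup containing all squares has index \<open>2\<close>.\<close>

section \<open>Weights of invariant metrics\<close>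

lemma invariant_metric_weight_mult:
  assumes "group G" "invariant_metric G d" "x \<in> carrier G" "y \<in> carrier G"
  shows "weight G d (x \<otimes>\<^bsub>G\<^esub> y) \<le> weight G d x + weight G d y"
proof -
  interpret group G by fact
  interpret M: Metric_space "carrier G" d
    using assms(2) by (simp add: invariant_metric_def)
  have "d (x \<otimes>\<^bsub>G\<^esub> y) \<one>\<^bsub>G\<^esub> \<le> d (x \<otimes>\<^bsub>G\<^esub> y) y + d y \<one>\<^bsub>G\<^esub>"
    using assms by (intro M.triangle) auto
  moreover have "d (x \<otimes>\<^bsub>G\<^esub> y) (\<one>\<^bsub>G\<^esub> \<otimes>\<^bsub>G\<^esub> y) = d x \<one>\<^bsub>G\<^esub>"
    using assms unfolding invariant_metric_def by blast
  ultimately show ?thesis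
    using assms by (simp add: weight_def)
qed

lemma invariant_metric_weight_inv:
  assumes "group G" "invariant_metric G d" "x \<in> carrier G"
  shows "weight G d (inv\<^bsub>G\<^esub> x) = weight G d x"
proof -
  interpret group G by fact
  interpret M: Metric_space "carrier G" d
    using assms(2) by (simp add: invariant_metric_def)
  have "d (inv\<^bsub>G\<^esub> x \<otimes>\<^bsub>G\<^esub> x) (\<one>\<^bsub>G\<^esub> \<otimes>\<^bsub>G\<^esub> x) = d (inv\<^bsub>G\<^esub> x) \<one>\<^bsub>G\<^esub>"
    using assms unfolding invariant_metric_def by (meson inv_closed one_closed)
  then show ?thesis
    using assms by (simp add: weight_def M.commute)
qed

lemma invariant_metric_weight_eq_0_iff:
  assumes "group G" "invariant_metric G d" "x \<in> carrier G"
  shows "weight G d x = 0 \<longleftrightarrow> x = \<one>\<^bsub>G\<^esub>"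
proof -
  interpret group G by fact
  interpret M: Metric_space "carrier G" d
    using assms(2) by (simp add: invariant_metric_def)
  show ?thesis
    using assms by (simp add: weight_def)
qed

text \<open>Two elements have equal weight exactly when some class contains both, and that condition
  mentions only the partition.\<close>

lemma metric_partition_eq_imp:
  assumes "metric_partition G d = metric_partition G d'" "x \<in> carrier G" "y \<in> carrier G"
  shows "weight G d x = weight G d y \<longleftrightarrow> weight G d' x = weight G d' y"
proof -
  define R where
    "R d = {(g, h). g \<in> carrier G \<and> h \<in> carrier G \<and> weight G d g = weight G d h}" for d
  have part: "weight G d x = weight G d y \<longleftrightarrow> (\<exists>X \<in> metric_partition G d. x \<in> X \<and> y \<in> X)" for d
  proof -
    have "equiv (carrier G) (R d)"
      by (auto simp: R_def intro!: equivI refl_onI symI transI)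
    then have "(x, y) \<in> R d \<longleftrightarrow> (\<exists>X \<in> carrier G // R d. x \<in> X \<and> y \<in> X)"
      using assms(2,3) by (metis equiv_class_self in_quotient_imp_in_rel insert_subset empty_subsetI
          quotientI Image_singleton_iff)
    then show ?thesis
      using assms(2,3) by (simp add: R_def metric_partition_def)
  qed
  show ?thesis
    using part[of d] part[of d'] assms(1) by simp
qed

text \<open>Values in \<open>{c..2c}\<close> off the identity make the triangle inequality automatic.\<close>

lemma ex_invariant_metric_weight:
  fixes f :: "'a \<Rightarrow> real"
  assumes "group G" "f \<one>\<^bsub>G\<^esub> = 0" "c > 0"
    and int: "\<And>x. x \<in> carrier G \<Longrightarrow> f x \<in> \<int>"
    and inv: "\<And>x. x \<in> carrier G \<Longrightarrow> f (inv\<^bsub>G\<^esub> x) = f x"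
    and bounds: "\<And>x. x \<in> carrier G \<Longrightarrow> x \<noteq> \<one>\<^bsub>G\<^esub> \<Longrightarrow> c \<le> f x \<and> f x \<le> 2 * c"
  obtains d where "invariant_metric G d" "\<And>x. x \<in> carrier G \<Longrightarrow> weight G d x = f x"
proof
  interpret group G by fact
  \<comment> \<open>Right invariance forces this formula. The value 0 off the carrier keeps
    \<open>d\<close> symmetric and nonnegative on the whole type.\<close>
  define d where
    "d x y = (if x \<in> carrier G \<and> y \<in> carrier G then f (x \<otimes>\<^bsub>G\<^esub> inv\<^bsub>G\<^esub> y) else 0)" for x y
  have f_nonneg: "0 \<le> f x" if "x \<in> carrier G" for x
    using bounds[OF that] assms(2,3) by (cases "x = \<one>\<^bsub>G\<^esub>") auto
  have f_zero: "f x = 0 \<longleftrightarrow> x = \<one>\<^bsub>G\<^esub>" if "x \<in> carrier G" for x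
    using bounds[OF that] assms(2,3) by (cases "x = \<one>\<^bsub>G\<^esub>") auto
  have f_mult: "f (x \<otimes>\<^bsub>G\<^esub> y) \<le> f x + f y" if "x \<in> carrier G" "y \<in> carrier G" for x y
  proof (cases "x = \<one>\<^bsub>G\<^esub> \<or> y = \<one>\<^bsub>G\<^esub> \<or> x \<otimes>\<^bsub>G\<^esub> y = \<one>\<^bsub>G\<^esub>")
    case True
    then show ?thesis using that f_nonneg assms(2) by auto
  next
    case False
    then show ?thesis
      using bounds[of x] bounds[of y] bounds[of "x \<otimes>\<^bsub>G\<^esub> y"] that by fastforce
  qed
  have d_zero: "d x y = 0 \<longleftrightarrow> x = y" if "x \<in> carrier G" "y \<in> carrier G" for x y
    using that f_zero[of "x \<otimes>\<^bsub>G\<^esub> inv\<^bsub>G\<^esub> y"] by (simp add: d_def) (metis inv_inv inv_equality r_inv inv_closed)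
  have "Metric_space (carrier G) d"
  proof
    show "d x y = d y x" for x y
      using inv[of "x \<otimes>\<^bsub>G\<^esub> inv\<^bsub>G\<^esub> y"] by (auto simp: d_def inv_mult_group)
    show "d x z \<le> d x y + d y z"
      if "x \<in> carrier G" "y \<in> carrier G" "z \<in> carrier G" for x y z
    proof -
      have "(x \<otimes>\<^bsub>G\<^esub> inv\<^bsub>G\<^esub> y) \<otimes>\<^bsub>G\<^esub> (y \<otimes>\<^bsub>G\<^esub> inv\<^bsub>G\<^esub> z) = x \<otimes>\<^bsub>G\<^esub> inv\<^bsub>G\<^esub> z"
        using that by (simp add: m_assoc) (simp add: m_assoc[symmetric])
      then show ?thesis
        using f_mult[of "x \<otimes>\<^bsub>G\<^esub> inv\<^bsub>G\<^esub> y" "y \<otimes>\<^bsub>G\<^esub> inv\<^bsub>G\<^esub> z"] that by (simp add: d_def)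
    qed
  qed (use f_nonneg d_zero in \<open>auto simp: d_def\<close>)
  moreover have "d (g \<otimes>\<^bsub>G\<^esub> h) (g' \<otimes>\<^bsub>G\<^esub> h) = d g g'"
    if "g \<in> carrier G" "g' \<in> carrier G" "h \<in> carrier G" for g g' h
  proof -
    have "(g \<otimes>\<^bsub>G\<^esub> h) \<otimes>\<^bsub>G\<^esub> inv\<^bsub>G\<^esub> (g' \<otimes>\<^bsub>G\<^esub> h) = g \<otimes>\<^bsub>G\<^esub> inv\<^bsub>G\<^esub> g'"
      using that by (simp add: inv_mult_group m_assoc) (simp add: m_assoc[symmetric])
    then show ?thesis using that by (simp add: d_def)
  qed
  ultimately show "invariant_metric G d"
    by (simp add: invariant_metric_def int d_def)
  show "weight G d x = f x" if "x \<in> carrier G" for x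
    using that by (simp add: weight_def d_def)
qed

section \<open>Inverse-closed pieces and the numerical contradiction\<close>

text \<open>A fixed point together with one further orbit, or a single orbit of size 2, suffices.
  The upper bound leaves enough elements to repeat the choice in the complement.\<close>

lemma ex_small_invariant_subset:
  assumes "2 \<le> card S" "\<And>x. x \<in> S \<Longrightarrow> i x \<in> S" "\<And>x. x \<in> S \<Longrightarrow> i (i x) = x"
  obtains A where "A \<subseteq> S" "\<And>x. x \<in> A \<Longrightarrow> i x \<in> A" "2 \<le> card A" "card A \<le> 3"
proof -
  obtain x y where xy: "x \<in> S" "y \<in> S" "x \<noteq> y"
    using assms(1) by (metis card_2_iff' card_le_Suc_iff numeral_2_eq_2 insertCI)
  show thesis
  proof (cases "i x = x")
    case True
    show thesis
    proof (rule that)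
      show "{x, y, i y} \<subseteq> S" using xy assms by auto
      show "i z \<in> {x, y, i y}" if "z \<in> {x, y, i y}" for z using that True xy assms by auto
      show "2 \<le> card {x, y, i y}"
        using xy card_mono[of "{x, y, i y}" "{x, y}"] by simp
      show "card {x, y, i y} \<le> 3" by (auto simp: card_insert_if)
    qed
  next
    case False
    show thesis
      by (rule that[of "{x, i x}"]) (use False xy assms in \<open>auto simp: card_insert_if\<close>)
  qed
qed

text \<open>Four distinct values from a set of four leave 24 assignments, each violating one of the
  inequalities.\<close>

lemma no_interval_weights:
  fixes b a1 a2 a3 :: real
  assumes "{b, a1, a2, a3} \<subseteq> {1, 2, 3, 4}" "distinct [b, a1, a2, a3]"
    and "\<And>x. x \<in> {a1, a2, a3} \<Longrightarrow> b \<le> 2 * x"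
    and "\<And>x y. x \<in> {a1, a2, a3} \<Longrightarrow> y \<in> {a1, a2, a3} \<Longrightarrow> x \<le> y + b"
  shows False
  using assms(1,2) assms(3)[of a1] assms(3)[of a2] assms(3)[of a3]
    assms(4)[of a1 a2] assms(4)[of a1 a3] assms(4)[of a2 a1] assms(4)[of a2 a3]
    assms(4)[of a3 a1] assms(4)[of a3 a2]
  by auto

section \<open>Groups with a subgroup of index 2\<close>

text \<open>There is only one right coset besides \<open>H\<close>, so \<open>x\<close> and
  \<open>y\<close> share it.\<close>

lemma (in group) index_2_mult_inv:
  assumes "subgroup H G" "card (rcosets H) = 2"
    and "x \<in> carrier G - H" "y \<in> carrier G - H"
  shows "x \<otimes> inv y \<in> H"
proof -
  have in_rcosets: "H \<in> rcosets H" "H #> x \<in> rcosets H" "H #> y \<in> rcosets H"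
    using assms subgroup.subset[OF assms(1)] by (auto intro: rcosetsI subgroup.subgroup_in_rcosets[OF _ is_group])
  have "H #> x \<noteq> H" "H #> y \<noteq> H"
    using assms rcos_self[of _ H] by auto
  with in_rcosets have "H #> x = H #> y"
    using assms(2) by (auto simp: card_2_iff)
  then have "x \<in> H #> y"
    using assms rcos_self[of x H] by auto
  then show ?thesis
    using assms subgroup.rcos_module_imp[OF assms(1) is_group, of y x] by auto
qed

lemma (in group) index_2_ex_non_P_interval:
  assumes "subgroup H G" "card (rcosets H) = 2" "finite (carrier G)" "order G \<ge> 16"
  shows "\<exists>d. invariant_metric G d \<and> \<not> P_interval G d"
proof -
  interpret H: subgroup H G by fact
  define S where "S = carrier G - H"
  have fin: "finite H" "finite S"
    using assms(3) H.subset by (auto simp: S_def finite_subset)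
  have card: "2 * card H = order G"
    using lagrange_finite[OF assms(3,1)] assms(2) by simp
  then have card_S: "card S \<ge> 8"
    using card_Diff_subset[OF fin(1) H.subset] assms(4) by (simp add: S_def order_def)
  have S_inv: "inv x \<in> S" if "x \<in> S" for x
    using that H.m_inv_closed[of "inv x"] by (auto simp: S_def)
  have S_carrier: "x \<in> carrier G" if "x \<in> S" for x
    using that by (simp add: S_def)
  obtain A1 where A1: "A1 \<subseteq> S" "\<And>x. x \<in> A1 \<Longrightarrow> inv x \<in> A1" "2 \<le> card A1" "card A1 \<le> 3"
    using ex_small_invariant_subset[of S "\<lambda>x. inv x"] card_S S_inv S_carrier by auto
  \<comment> \<open>At most 3 of at least 8 elements are removed; removing at most 3 more still
    leaves 2 for \<open>A3\<close>.\<close>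
  have card_S1: "card (S - A1) \<ge> 5"
    using card_Diff_subset[of A1 S] finite_subset[OF A1(1) fin(2)] A1 card_S by simp
  have S1_inv: "inv x \<in> S - A1" if "x \<in> S - A1" for x
    using that S_inv[of x] A1(2)[of "inv x"] S_carrier[of x] by auto
  obtain A2 where A2: "A2 \<subseteq> S - A1" "\<And>x. x \<in> A2 \<Longrightarrow> inv x \<in> A2" "2 \<le> card A2" "card A2 \<le> 3"
    using ex_small_invariant_subset[of "S - A1" "\<lambda>x. inv x"] card_S1 S1_inv S_carrier by auto
  define A3 where "A3 = S - A1 - A2"
  have card_A3: "2 \<le> card A3"
    using card_Diff_subset[of A2 "S - A1"] finite_subset[OF A2(1)] fin(2) A2 card_S1
    by (simp add: A3_def)
  have A3_inv: "inv x \<in> A3" if "x \<in> A3" for x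
    using that S1_inv[of x] A2(2)[of "inv x"] S_carrier[of x] by (auto simp: A3_def)
  \<comment> \<open>Any distinct integers in the range from 4 to 8 would do for the four nontrivial
    classes; the default 7 is the value on \<open>A3\<close>.\<close>
  define f :: "'a \<Rightarrow> real" where
    "f x = (if x = \<one> then 0 else if x \<in> H then 4 else if x \<in> A1 then 5
      else if x \<in> A2 then 6 else 7)" for x
  have f_inv: "f (inv x) = f x" if x: "x \<in> carrier G" for x
  proof -
    have "inv x \<in> T \<longleftrightarrow> x \<in> T" if "\<And>y. y \<in> T \<Longrightarrow> inv y \<in> T" for T
      using that[of x] that[of "inv x"] x by auto
    then show ?thesis
      using x A1(2) A2(2) by (simp add: f_def)
  qed
  obtain d where d: "invariant_metric G d" and weight_d: "\<And>x. x \<in> carrier G \<Longrightarrow> weight G d x = f x"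
    by (rule ex_invariant_metric_weight[of G f 4]) (auto simp: f_inv is_group, auto simp: f_def)
  have "\<not> P_interval G d"
  proof
    assume "P_interval G d"
    then obtain d' where d': "interval_metric G d'" "metric_partition G d' = metric_partition G d"
      by (auto simp: P_interval_def)
    define w where "w = weight G d'"
    have inv_d': "invariant_metric G d'"
      using d' by (simp add: interval_metric_def)
    have w_mult: "w (x \<otimes> y) \<le> w x + w y" if "x \<in> carrier G" "y \<in> carrier G" for x y
      using invariant_metric_weight_mult[OF is_group inv_d' that] by (simp add: w_def)
    have w_inv: "w (inv x) = w x" if "x \<in> carrier G" for x
      using invariant_metric_weight_inv[OF is_group inv_d' that] by (simp add: w_def)
    have w_eq: "w x = w y \<longleftrightarrow> f x = f y" if "x \<in> carrier G" "y \<in> carrier G" for x y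
      using metric_partition_eq_imp[OF d'(2) that] that by (simp add: w_def weight_d)
    have w_0: "w x = 0 \<longleftrightarrow> x = \<one>" if "x \<in> carrier G" for x
      using invariant_metric_weight_eq_0_iff[OF is_group inv_d' that] by (simp add: w_def)
    have "card (H - {\<one>}) \<noteq> 0"
      using card assms(4) by simp
    then obtain h where h: "h \<in> H" "h \<noteq> \<one>"
      by (metis DiffE all_not_in_conv card.empty singletonI)
    \<comment> \<open>Two distinct elements of one piece are needed so that their quotient is not
      the identity.\<close>
    have two: "\<exists>x y. x \<in> T \<and> y \<in> T \<and> x \<noteq> y" if "2 \<le> card T" for T :: "'a set"
      using that by (metis card_2_iff' card_le_Suc_iff numeral_2_eq_2 insertCI)
    obtain x1 y1 where 1: "x1 \<in> A1" "y1 \<in> A1" "x1 \<noteq> y1" using two[OF A1(3)] by auto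
    obtain x2 y2 where 2: "x2 \<in> A2" "y2 \<in> A2" "x2 \<noteq> y2" using two[OF A2(3)] by auto
    obtain x3 y3 where 3: "x3 \<in> A3" "y3 \<in> A3" "x3 \<noteq> y3" using two[OF card_A3] by auto
    have in_S: "x1 \<in> S" "y1 \<in> S" "x2 \<in> S" "y2 \<in> S" "x3 \<in> S" "y3 \<in> S"
      using 1 2 3 A1(1) A2(1) by (auto simp: A3_def)
    have not_one: "x \<noteq> \<one>" if "x \<in> S" for x
      using that by (auto simp: S_def)
    have f_vals: "f h = 4" "f x1 = 5" "f y1 = 5" "f x2 = 6" "f y2 = 6" "f x3 = 7" "f y3 = 7"
      using h in_S not_one 1 2 3 A2(1) by (auto simp: f_def S_def A3_def)
    have h_carrier: "h \<in> carrier G"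
      using h H.subset by auto
    note in_G = h_carrier in_S[THEN S_carrier]
    have "f ` carrier G = {0, 4, 5, 6, 7}"
    proof
      show "f ` carrier G \<subseteq> {0, 4, 5, 6, 7}" by (auto simp: f_def)
      have "f \<one> = 0" by (simp add: f_def)
      then show "{0, 4, 5, 6, 7} \<subseteq> f ` carrier G"
        using f_vals in_G one_closed by (auto simp: image_iff)
    qed
    then have "card (f ` carrier G) = 5" by simp
    \<comment> \<open>By \<open>w_eq\<close>, \<open>f\<close> and \<open>w\<close> have the same
      fibres, so sending a value of \<open>f\<close> to the weight of any preimage is a bijection.
      Five values then force \<open>m = 4\<close>.\<close>
    moreover have "card (f ` carrier G) = card (w ` carrier G)"
    proof (rule bij_betw_same_card)
      show "bij_betw (\<lambda>v. w (inv_into (carrier G) f v)) (f ` carrier G) (w ` carrier G)"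
        unfolding bij_betw_def
      proof
        show "inj_on (\<lambda>v. w (inv_into (carrier G) f v)) (f ` carrier G)"
          by (rule inj_onI) (metis w_eq f_inv_into_f inv_into_into)
        have "w (inv_into (carrier G) f (f x)) = w x" if "x \<in> carrier G" for x
          using that w_eq by (metis f_inv_into_f inv_into_into imageI)
        then show "(\<lambda>v. w (inv_into (carrier G) f v)) ` f ` carrier G = w ` carrier G"
          by (auto simp: image_iff)
      qed
    qed
    moreover obtain m where m: "w ` carrier G = real ` {0..m}"
      using d'(1) by (auto simp: interval_metric_def w_def)
    moreover have "card (real ` {0..m}) = Suc m"
      by (subst card_image) auto
    ultimately have "w ` carrier G = real ` {0..4}" by simp
    also have "\<dots> = {0, 1, 2, 3, 4}"
      by (auto simp: atLeast0AtMost numeral_eq_Suc atMost_Suc)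
    finally have w_range: "w ` carrier G = {0, 1, 2, 3, 4}" .
    have w_vals: "w x \<in> {1, 2, 3, 4}" if "x \<in> carrier G" "x \<noteq> \<one>" for x
      using w_range w_0[OF that(1)] that by (metis image_eqI insertE)
    \<comment> \<open>Write \<open>x\<close> as the quotient \<open>x \<otimes> inv y\<close> times
      \<open>y\<close>. All nonidentity elements of \<open>H\<close> have the weight of
      \<open>h\<close>.\<close>
    have w_diff: "w x \<le> w y + w h" if "x \<in> S" "y \<in> S" for x y
    proof (cases "x = y")
      case True
      then show ?thesis
        using w_vals[OF h_carrier h(2)] by auto
    next
      case False
      let ?q = "x \<otimes> inv y"
      have q: "?q \<in> H" "?q \<noteq> \<one>"
        using index_2_mult_inv[OF assms(1,2), of x y] that False
        by (auto simp: S_def) (metis inv_equality inv_inv inv_closed)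
      then have "w ?q = w h"
        using w_eq[of ?q h] h h_carrier S_carrier that by (simp add: f_def)
      moreover have "x = ?q \<otimes> y"
        using that S_carrier by (simp add: m_assoc)
      ultimately show ?thesis
        using w_mult[of ?q y] that S_carrier by simp
    qed
    \<comment> \<open>Here the quotient itself is bounded: it has weight \<open>w h\<close>, while
      \<open>x\<close> and \<open>inv y\<close> both have weight \<open>w x\<close>.\<close>
    have w_double: "w h \<le> 2 * w x" if "x \<in> S" "y \<in> S" "x \<noteq> y" "f x = f y" for x y
    proof -
      let ?q = "x \<otimes> inv y"
      have q: "?q \<in> H" "?q \<noteq> \<one>"
        using index_2_mult_inv[OF assms(1,2), of x y] that
        by (auto simp: S_def) (metis inv_equality inv_inv inv_closed)
      then have "w ?q = w h"
        using w_eq[of ?q h] h h_carrier S_carrier that by (simp add: f_def)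
      moreover have "w x = w y"
        using that w_eq S_carrier by simp
      ultimately show ?thesis
        using w_mult[of x "inv y"] w_inv[of y] that S_carrier by simp
    qed
    show False
    proof (rule no_interval_weights[of "w h" "w x1" "w x2" "w x3"])
      show "{w h, w x1, w x2, w x3} \<subseteq> {1, 2, 3, 4}"
        using w_vals in_G not_one in_S h(2) by blast
      show "distinct [w h, w x1, w x2, w x3]"
        using in_G by (simp add: w_eq f_vals)
      show "w h \<le> 2 * u" if "u \<in> {w x1, w x2, w x3}" for u
        using that w_double[of x1 y1] w_double[of x2 y2] w_double[of x3 y3] in_S f_vals 1 2 3
        by auto
      show "u \<le> v + w h" if "u \<in> {w x1, w x2, w x3}" "v \<in> {w x1, w x2, w x3}" for u v
        using that w_diff in_S by blast
    qed
  qed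
  with d show ?thesis by blast
qed

section \<open>Abelian groups of even order\<close>

lemma (in comm_group) ex_index_2_subgroup:
  assumes "finite (carrier G)" "even (order G)"
  shows "\<exists>H. subgroup H G \<and> card (rcosets H) = 2"
proof -
  define sq where "sq x = x \<otimes> x" for x
  have sq_hom: "sq \<in> hom G G"
    by (rule homI) (auto simp: sq_def m_ac)
  obtain m where "order G = 2 ^ 1 * m"
    using assms(2) by auto
  then obtain K where K: "subgroup K G" "card K = 2"
    using sylow_thm[of 2 G 1 m] assms(1) is_group by auto
  interpret K: subgroup K G by fact
  obtain t where t: "K = {\<one>, t}" "t \<noteq> \<one>"
    using K(2) K.one_closed by (metis card_2_iff doubleton_eq_iff insertE singletonD)
  have "t \<in> carrier G" "t \<otimes> t \<in> K"
    using t K.subset K.m_closed[of t t] by simp_all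
  \<comment> \<open>The other possibility in \<open>K\<close>, namely
    \<open>t \<otimes> t = t\<close>, would make \<open>t\<close> the identity.\<close>
  then have "sq t = sq \<one>"
    using t by (auto simp: sq_def)
  then have "\<not> inj_on sq (carrier G)"
    using t(2) \<open>t \<in> carrier G\<close> inj_onD by fastforce
  then have sq_proper: "sq ` carrier G \<noteq> carrier G"
    using eq_card_imp_inj_on[OF assms(1), of sq] by auto
  define \<H> where "\<H> = {H. subgroup H G \<and> H \<noteq> carrier G \<and> sq ` carrier G \<subseteq> H}"
  have "finite \<H>"
    by (rule finite_subset[of _ "Pow (carrier G)"]) (auto simp: \<H>_def assms(1) dest: subgroup.subset)
  \<comment> \<open>The squares form a subgroup because squaring is a homomorphism, so \<H> is
    nonempty and has a maximal element.\<close>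
  moreover have "sq ` carrier G \<in> \<H>"
    using group_hom.img_is_subgroup[of G G sq] sq_hom sq_proper
    by (auto simp: \<H>_def group_hom_def group_hom_axioms_def is_group)
  ultimately obtain M where M: "M \<in> \<H>" and max: "\<And>N. N \<in> \<H> \<Longrightarrow> M \<subseteq> N \<Longrightarrow> M = N"
    using finite_has_maximal[of \<H>] by blast
  interpret M: subgroup M G using M by (simp add: \<H>_def)
  have sq_M: "x \<otimes> x \<in> M" if "x \<in> carrier G" for x
    using M that by (auto simp: \<H>_def sq_def)
  obtain x where x: "x \<in> carrier G" "x \<notin> M"
    using M M.subset by (auto simp: \<H>_def)
  define N where "N = M \<union> (M #> x)"
  \<comment> \<open>Since \<open>x \<otimes> x\<close> lies in \<open>M\<close>, multiplying by
    \<open>x\<close> acts like dividing by it. This form of the coset avoids witnesses when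
    \<open>N\<close> is shown to be a subgroup.\<close>
  have coset: "M #> x = {y \<in> carrier G. y \<otimes> x \<in> M}"
  proof (intro equalityI subsetI)
    fix y assume "y \<in> M #> x"
    then obtain h where h: "h \<in> M" "y = h \<otimes> x" by (auto simp: r_coset_def)
    then have "y \<otimes> x = h \<otimes> (x \<otimes> x)" using x M.subset by (auto simp: m_assoc)
    then show "y \<in> {y \<in> carrier G. y \<otimes> x \<in> M}" using h x sq_M M.subset by auto
  next
    fix y assume "y \<in> {y \<in> carrier G. y \<otimes> x \<in> M}"
    then have y: "y \<in> carrier G" "y \<otimes> x \<in> M" by auto
    have "y = ((y \<otimes> x) \<otimes> inv (x \<otimes> x)) \<otimes> x"
      using x y by (simp add: inv_mult_group m_assoc)
    moreover have "(y \<otimes> x) \<otimes> inv (x \<otimes> x) \<in> M"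
      using y sq_M x by auto
    ultimately show "y \<in> M #> x" unfolding r_coset_def by blast
  qed
  have "subgroup N G"
  proof
    show "N \<subseteq> carrier G" using M.subset by (auto simp: N_def coset)
    show "\<one> \<in> N" by (simp add: N_def)
    show "y \<otimes> z \<in> N" if "y \<in> N" "z \<in> N" for y z
    proof -
      have yz: "y \<in> carrier G" "z \<in> carrier G"
        using that M.subset by (auto simp: N_def coset)
      \<comment> \<open>A product of two elements of the nontrivial coset falls back into
        \<open>M\<close>, again because \<open>x \<otimes> x\<close> does.\<close>
      have "y \<otimes> z \<in> M" if "y \<otimes> x \<in> M" "z \<otimes> x \<in> M"
      proof -
        have "(y \<otimes> x) \<otimes> (z \<otimes> x) = (y \<otimes> z) \<otimes> (x \<otimes> x)"
          using x yz by (simp add: m_ac)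
        then have "y \<otimes> z = ((y \<otimes> x) \<otimes> (z \<otimes> x)) \<otimes> inv (x \<otimes> x)"
          using x yz by (simp add: m_assoc del: inv_mult_group)
        then show ?thesis using that sq_M x by auto
      qed
      moreover have "(y \<otimes> z) \<otimes> x \<in> M" if "y \<otimes> x \<in> M" "z \<in> M"
        using M.m_closed[OF that] x yz by (simp add: m_ac)
      moreover have "(y \<otimes> z) \<otimes> x \<in> M" if "y \<in> M" "z \<otimes> x \<in> M"
        using M.m_closed[OF that] x yz by (simp add: m_ac)
      ultimately show ?thesis
        using that yz by (auto simp: N_def coset)
    qed
    show "inv y \<in> N" if "y \<in> N" for y
    proof -
      have y: "y \<in> carrier G"
        using that M.subset by (auto simp: N_def coset)
      have "inv y \<otimes> x = inv (y \<otimes> x) \<otimes> (x \<otimes> x)"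
        using x y by (simp add: inv_mult m_assoc) (simp add: m_assoc[symmetric])
      then show ?thesis
        using that y sq_M x by (auto simp: N_def coset)
    qed
  qed
  moreover have "x \<in> N"
    using x sq_M by (simp add: N_def coset)
  \<comment> \<open>\<open>N\<close> contains \<open>M\<close> and also \<open>x\<close>, so it
    would contradict maximality if it were proper.\<close>
  ultimately have N: "N = carrier G"
    using max[of N] M x by (auto simp: N_def \<H>_def)
  have "rcosets M = {M, M #> x}"
  proof
    show "{M, M #> x} \<subseteq> rcosets M"
      using x M.subset by (auto intro: rcosetsI M.subgroup_in_rcosets is_group)
    have "M #> y \<in> {M, M #> x}" if "y \<in> carrier G" for y
      using that N M.rcos_const[OF is_group] repr_independence[of y M x] x M.subgroup_axioms
      by (auto simp: N_def)
    then show "rcosets M \<subseteq> {M, M #> x}" by (auto simp: RCOSETS_def)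
  qed
  moreover have "M #> x \<noteq> M"
    using x rcos_self[OF x(1) M.subgroup_axioms] by auto
  ultimately show ?thesis
    using M.subgroup_axioms by (metis card_2_iff)
qed

theorem corollary2p14:
  fixes G :: "('a, 'b) monoid_scheme"
  shows "(group G \<and> finite (carrier G) \<and> order G \<ge> 16 \<and>
            (\<exists>H. subgroup H G \<and> card (rcosets\<^bsub>G\<^esub> H) = 2)
          \<longrightarrow> (\<exists>d. invariant_metric G d \<and> \<not> P_interval G d))
       \<and> (\<forall>n::nat. comm_group G \<and> finite (carrier G) \<and> order G = 2 * n \<and> n \<ge> 8
          \<longrightarrow> (\<exists>d. invariant_metric G d \<and> \<not> P_interval G d))"
proof (intro conjI allI impI)
  assume "group G \<and> finite (carrier G) \<and> order G \<ge> 16 \<and>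
            (\<exists>H. subgroup H G \<and> card (rcosets\<^bsub>G\<^esub> H) = 2)"
  then show "\<exists>d. invariant_metric G d \<and> \<not> P_interval G d"
    using group.index_2_ex_non_P_interval by blast
next
  fix n :: nat
  assume n: "comm_group G \<and> finite (carrier G) \<and> order G = 2 * n \<and> n \<ge> 8"
  then obtain H where "subgroup H G" "card (rcosets\<^bsub>G\<^esub> H) = 2"
    using comm_group.ex_index_2_subgroup[of G] by auto
  with n show "\<exists>d. invariant_metric G d \<and> \<not> P_interval G d"
    using group.index_2_ex_non_P_interval[of G H] by (auto simp: comm_group_def)
qed

end
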